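(* Let $\lambda$ be a regular content on a Hausdorff space $X$ and assume that the induced measure $\lambda_*$ on $X$ is locally finite. Suppose $f:(Y,\mu)\rightarrow(X,\lambda_* )$ is a measure-preserving continuous map, with $Y$ a Boolean locale and $\mu$ a locally finite and faithful measure on $Y$. Then there exists a unique measure-preserving continuous map $\tilde f:(Y,\mu)\rightarrow(X^\lambda,\lambda_* )$ such that $p\circ\tilde f=f$, where $p:X^\lambda\to X$ is the natural map.
   Context: A frame is a poset with arbitrary suprema and finite infima satisfying $V\wedge\bigvee_i U_i=\bigvee_i(V\wedge U_i)$; locales are the objects of the opposite category of frames, $\mathcal{O}(L)$ is the frame of $L$, and a continuous map $f:L\to M$ is a frame homomorphism $f^*:\mathcal{O}(M)\to\mathcal{O}(L)$ (preserving arbitrary suprema and finite infima, including the top). Hausdorff spaces are identified with the locales of their frames of opens. A locale is Boolean if every open has a complement. A measure on $L$ is a monotone map $\nu:\mathcal{O}(L)\to[0,\infty]$ with $\nu(0)=0$, $\nu(U)+\nu(V)=\nu(U\vee V)+\nu(U\wedge V)$, and $\nu(\bigvee_iU_i)=\sup_i\nu(U_i)$ for directed families. It is locally finite if $1$ is a supremum of opens of finite measure, and faithful if whenever $U\le V$ and $\nu(U\wedge K)=\nu(V\wedge K)$ for all $K$ with $\nu(K)<\infty$, then $U=V$. A continuous map $f:(L,\nu)\to(M,\nu')$ is measure-preserving if $\nu(f^*(U))=\nu'(U)$ for all opens $U$ of $M$. $\mathcal{K}(X)$ is the lattice of compact subsets of $X$. A content is a function $\lambda:\mathcal{K}(X)\to[0,+\infty)$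 that is monotone, subadditive ($\lambda(C\cup D)\le\lambda(C)+\lambda(D)$), and additive on disjoint pairs. Write $K_1\ll K_2$ if there is an open $U$ with $K_1\subset U\subset K_2$. A content is regular if $\lambda(K)=\inf\{\lambda(K')\mid K\ll K',\ K'\text{ compact}\}$ for all compact $K$ (infimum in $[0,+\infty]$). On a Hausdorff space a regular content is modular: $\lambda(C)+\lambda(D)=\lambda(C\cup D)+\lambda(C\cap D)$. A $\lambda$-ideal is a downward closed $U\subset\mathcal{K}(X)$ such that $K\in U$ whenever there are $K_i\in U$ $(i\in I)$, $K_i\subset K$, such that for all $\epsilon>0$ some finite $F\subset I$ has $\lambda(K)-\lambda(\bigcup_{i\in F}K_i)<\epsilon$. The $\lambda$-ideals ordered by inclusion form the frame of a locale $X^\lambda$, with inner measure $\lambda_*(U)=\sup_{K\in U}\lambda(K)$. The natural map $p:X^\lambda\to X$ has inverse image sending an open $V\subset X$ to the smallest $\lambda$-ideal containing $\{K\subset V\mid K\text{ compact}\}$. The induced measure on $X$, also denoted $\lambda_*$, is the pushforward along $p$, i.e. $\lambda_*(V)=\sup\{\lambda(K)\mid K\subset V\text{ compact}\}$ for $V\subset X$ open. *)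

theory Defs
  imports "HOL-Analysis.Analysis" "HOL-Algebra.Complete_Lattice"
begin

section \<open>Frames and locales\<close>

text \<open>
  The type class \<open>complete_distrib_lattice\<close> (and hence \<open>complete_boolean_algebra\<close>) of Main asks
  for complete distributivity, which is much stronger than the frame law and would force a Boolean
  locale to be atomic. Frames are therefore built on the carrier-based complete lattices of
  HOL-Algebra. A locale is represented by its frame of opens.
\<close>

locale frame = complete_lattice +
  assumes meet_Sup_distrib:
    "\<lbrakk>V \<in> carrier L; A \<subseteq> carrier L\<rbrakk> \<Longrightarrow> V \<sqinter> \<Squnion> A = \<Squnion> ((\<lambda>U. V \<sqinter> U) ` A)"

locale boolean_frame = frame +
  assumes complement_exists:
    "U \<in> carrier L \<Longrightarrow> \<exists>V\<in>carrier L. U \<sqinter> V = \<bottom> \<and> U \<squnion> V = \<top>"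

text \<open>
  A continuous map from the locale \<open>L\<close> to the locale \<open>M\<close> is identified with its inverse image map,
  a frame homomorphism from \<open>M\<close> to \<open>L\<close>. These are taken to be extensional functions, so that
  equality of continuous maps is equality in HOL. As for \<^const>\<open>sup_pres\<close>, the predicate includes
  that both sides are structures of the right kind.
\<close>

definition continuous_maps :: "('a, 'm) gorder_scheme \<Rightarrow> ('b, 'n) gorder_scheme \<Rightarrow> ('b \<Rightarrow> 'a) set"
  where "continuous_maps L M =
    {h \<in> carrier M \<rightarrow>\<^sub>E carrier L.
       frame L \<and> frame M \<and>
       (\<forall>A \<subseteq> carrier M. h (\<Squnion>\<^bsub>M\<^esub> A) = \<Squnion>\<^bsub>L\<^esub> (h ` A)) \<and>
       h \<top>\<^bsub>M\<^esub> = \<top>\<^bsub>L\<^esub> \<and>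
       (\<forall>U \<in> carrier M. \<forall>V \<in> carrier M. h (U \<sqinter>\<^bsub>M\<^esub> V) = h U \<sqinter>\<^bsub>L\<^esub> h V)}"

text \<open>
  For \<open>f\<close> from \<open>L\<close> to \<open>M\<close> and \<open>g\<close> from \<open>M\<close> to \<open>N\<close>, given by their inverse images,
  the composite of \<open>g\<close> after \<open>f\<close> has as inverse image that of \<open>f\<close> after that of \<open>g\<close>.
\<close>

definition map_comp_loc :: "('c, 'n) gorder_scheme \<Rightarrow> ('c \<Rightarrow> 'b) \<Rightarrow> ('b \<Rightarrow> 'a) \<Rightarrow> ('c \<Rightarrow> 'a)"
  where "map_comp_loc N g f = compose (carrier N) f g"

definition opens_frame :: "'a topology \<Rightarrow> 'a set gorder"
  where "opens_frame X = \<lparr>carrier = {U. openin X U}, eq = (=), le = (\<subseteq>)\<rparr>"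

lemma frame_opens_frame: "frame (opens_frame X)"
proof -
  let ?L = "opens_frame X"
  have lub: "least ?L (\<Union>A) (Upper ?L A)" if "A \<subseteq> carrier ?L" for A
    using that by (auto simp: opens_frame_def least_def Upper_def)
  have glb: "greatest ?L (X interior_of (topspace X \<inter> \<Inter>A)) (Lower ?L A)" if A: "A \<subseteq> carrier ?L" for A
  proof -
    define T where "T = X interior_of (topspace X \<inter> \<Inter>A)"
    have 1: "openin X T" unfolding T_def by simp
    have 2: "T \<subseteq> U" if "U \<in> A" for U
      using interior_of_subset[of X "topspace X \<inter> \<Inter>A"] that unfolding T_def by blast
    have 3: "B \<subseteq> T" if "openin X B" "\<And>U. U \<in> A \<Longrightarrow> B \<subseteq> U" for B
      using that openin_subset[of X B] unfolding T_def by (intro interior_of_maximal) auto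
    have "B \<subseteq> T" if "B \<in> Lower ?L A" for B
      using that A by (intro 3) (auto simp: opens_frame_def Lower_def)
    moreover have "T \<in> Lower ?L A"
      using 1 2 by (simp add: opens_frame_def Lower_def)
    moreover have "Lower ?L A \<subseteq> carrier ?L"
      by (auto simp: Lower_def)
    ultimately show ?thesis
      unfolding T_def[symmetric] greatest_def by (simp add: opens_frame_def)
  qed
  interpret complete_lattice ?L
  proof
    show "\<exists>s. least ?L s (Upper ?L A)" if "A \<subseteq> carrier ?L" for A using lub[OF that] by blast
    show "\<exists>s. greatest ?L s (Lower ?L A)" if "A \<subseteq> carrier ?L" for A using glb[OF that] by blast
  qed (auto simp: opens_frame_def)
  have Sup: "\<Squnion>\<^bsub>?L\<^esub> A = \<Union>A" if "A \<subseteq> carrier ?L" for A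
    using lub[OF that] that least_unique sup_lub by blast
  have meet: "U \<sqinter>\<^bsub>?L\<^esub> V = U \<inter> V" if "U \<in> carrier ?L" "V \<in> carrier ?L" for U V
  proof -
    have "greatest ?L (U \<inter> V) (Lower ?L {U, V})"
      using that by (auto simp: opens_frame_def greatest_def Lower_def)
    then show ?thesis
      using that greatest_unique inf_glb[of "{U,V}"] by (auto simp: meet_def)
  qed
  show ?thesis
  proof
    fix V A assume *: "V \<in> carrier ?L" "A \<subseteq> carrier ?L"
    then have "\<Union>A \<in> carrier ?L" "(\<lambda>U. V \<inter> U) ` A \<subseteq> carrier ?L"
      by (auto simp: opens_frame_def)
    moreover have "(\<lambda>U. V \<sqinter>\<^bsub>?L\<^esub> U) ` A = (\<lambda>U. V \<inter> U) ` A"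
      using * meet by (intro image_cong) auto
    ultimately show "V \<sqinter>\<^bsub>?L\<^esub> \<Squnion>\<^bsub>?L\<^esub> A = \<Squnion>\<^bsub>?L\<^esub> ((\<lambda>U. V \<sqinter>\<^bsub>?L\<^esub> U) ` A)"
      using * by (simp add: Sup meet)
  qed
qed


section \<open>Measures on locales\<close>

definition directed_family :: "('a, 'm) gorder_scheme \<Rightarrow> 'a set \<Rightarrow> bool"
  where "directed_family L D \<longleftrightarrow> D \<subseteq> carrier L \<and> D \<noteq> {} \<and>
    (\<forall>U\<in>D. \<forall>V\<in>D. \<exists>W\<in>D. U \<sqsubseteq>\<^bsub>L\<^esub> W \<and> V \<sqsubseteq>\<^bsub>L\<^esub> W)"

definition locale_measure :: "('a, 'm) gorder_scheme \<Rightarrow> ('a \<Rightarrow> ennreal) \<Rightarrow> bool"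
  where "locale_measure L \<nu> \<longleftrightarrow>
    (\<forall>U\<in>carrier L. \<forall>V\<in>carrier L. U \<sqsubseteq>\<^bsub>L\<^esub> V \<longrightarrow> \<nu> U \<le> \<nu> V) \<and>
    \<nu> \<bottom>\<^bsub>L\<^esub> = 0 \<and>
    (\<forall>U\<in>carrier L. \<forall>V\<in>carrier L. \<nu> U + \<nu> V = \<nu> (U \<squnion>\<^bsub>L\<^esub> V) + \<nu> (U \<sqinter>\<^bsub>L\<^esub> V)) \<and>
    (\<forall>D. directed_family L D \<longrightarrow> \<nu> (\<Squnion>\<^bsub>L\<^esub> D) = (SUP U\<in>D. \<nu> U))"

definition locally_finite_measure :: "('a, 'm) gorder_scheme \<Rightarrow> ('a \<Rightarrow> ennreal) \<Rightarrow> bool"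
  where "locally_finite_measure L \<nu> \<longleftrightarrow>
    (\<exists>A. A \<subseteq> {U \<in> carrier L. \<nu> U < \<infinity>} \<and> \<Squnion>\<^bsub>L\<^esub> A = \<top>\<^bsub>L\<^esub>)"

definition faithful_measure :: "('a, 'm) gorder_scheme \<Rightarrow> ('a \<Rightarrow> ennreal) \<Rightarrow> bool"
  where "faithful_measure L \<nu> \<longleftrightarrow>
    (\<forall>U\<in>carrier L. \<forall>V\<in>carrier L.
       U \<sqsubseteq>\<^bsub>L\<^esub> V \<longrightarrow>
       (\<forall>K\<in>carrier L. \<nu> K < \<infinity> \<longrightarrow> \<nu> (U \<sqinter>\<^bsub>L\<^esub> K) = \<nu> (V \<sqinter>\<^bsub>L\<^esub> K)) \<longrightarrow> U = V)"

definition measure_preserving_maps ::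
    "('a, 'm) gorder_scheme \<Rightarrow> ('a \<Rightarrow> ennreal) \<Rightarrow>
     ('b, 'n) gorder_scheme \<Rightarrow> ('b \<Rightarrow> ennreal) \<Rightarrow> ('b \<Rightarrow> 'a) set"
  where "measure_preserving_maps L \<nu> M \<nu>' =
    {h \<in> continuous_maps L M. \<forall>U\<in>carrier M. \<nu> (h U) = \<nu>' U}"


section \<open>Contents\<close>

definition content_on :: "'a topology \<Rightarrow> ('a set \<Rightarrow> real) \<Rightarrow> bool"
  where "content_on X lam \<longleftrightarrow>
    (\<forall>C. compactin X C \<longrightarrow> 0 \<le> lam C) \<and>
    (\<forall>C D. compactin X C \<and> compactin X D \<and> C \<subseteq> D \<longrightarrow> lam C \<le> lam D) \<and>
    (\<forall>C D. compactin X C \<and> compactin X D \<longrightarrow> lam (C \<union> D) \<le> lam C + lam D) \<and>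
    (\<forall>C D. compactin X C \<and> compactin X D \<and> C \<inter> D = {} \<longrightarrow> lam (C \<union> D) = lam C + lam D)"

definition way_inside :: "'a topology \<Rightarrow> 'a set \<Rightarrow> 'a set \<Rightarrow> bool"
  where "way_inside X K1 K2 \<longleftrightarrow> (\<exists>U. openin X U \<and> K1 \<subseteq> U \<and> U \<subseteq> K2)"

text \<open>
  The infimum is taken in \<^typ>\<open>ennreal\<close>, where the infimum of the empty set is \<open>\<infinity>\<close>: a compact set
  without compact neighbourhood thus violates regularity.
\<close>

definition regular_content :: "'a topology \<Rightarrow> ('a set \<Rightarrow> real) \<Rightarrow> bool"
  where "regular_content X lam \<longleftrightarrow> content_on X lam \<and>
    (\<forall>K. compactin X K \<longrightarrow>
       ennreal (lam K) = (INF K'\<in>{K'. compactin X K' \<and> way_inside X K K'}. ennreal (lam K')))"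


section \<open>The locale associated with a content\<close>

text \<open>
  The family \<open>K\<^sub>i\<close> enters the closure condition only through its set of members, so it is given as
  a subset \<open>\<K>\<close> of the ideal, possibly empty (the empty subfamily has union \<open>{}\<close>).
\<close>

definition content_ideal :: "'a topology \<Rightarrow> ('a set \<Rightarrow> real) \<Rightarrow> 'a set set \<Rightarrow> bool"
  where "content_ideal X lam U \<longleftrightarrow>
    U \<subseteq> {K. compactin X K} \<and>
    (\<forall>K\<in>U. \<forall>C. compactin X C \<and> C \<subseteq> K \<longrightarrow> C \<in> U) \<and>
    (\<forall>K \<K>. compactin X K \<and> \<K> \<subseteq> U \<and> (\<forall>C\<in>\<K>. C \<subseteq> K) \<and>
       (\<forall>\<epsilon>>0. \<exists>F. finite F \<and> F \<subseteq> \<K> \<and> lam K - lam (\<Union>F) < \<epsilon>) \<longrightarrow> K \<in> U)"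

definition content_frame :: "'a topology \<Rightarrow> ('a set \<Rightarrow> real) \<Rightarrow> 'a set set gorder"
  where "content_frame X lam = \<lparr>carrier = {U. content_ideal X lam U}, eq = (=), le = (\<subseteq>)\<rparr>"

definition inner_measure :: "('a set \<Rightarrow> real) \<Rightarrow> 'a set set \<Rightarrow> ennreal"
  where "inner_measure lam U = (SUP K\<in>U. ennreal (lam K))"

text \<open>An intersection of \<open>\<lambda>\<close>-ideals is a \<open>\<lambda>\<close>-ideal, so this is the smallest one containing \<open>S\<close>.\<close>

definition generated_ideal :: "'a topology \<Rightarrow> ('a set \<Rightarrow> real) \<Rightarrow> 'a set set \<Rightarrow> 'a set set"
  where "generated_ideal X lam S = \<Inter>{I. content_ideal X lam I \<and> S \<subseteq> I}"

text \<open>The map \<open>p\<close> from \<open>X\<^sup>\<lambda>\<close> to \<open>X\<close>, given by its inverse image.\<close>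

definition natural_map :: "'a topology \<Rightarrow> ('a set \<Rightarrow> real) \<Rightarrow> 'a set \<Rightarrow> 'a set set"
  where "natural_map X lam =
    (\<lambda>V\<in>carrier (opens_frame X). generated_ideal X lam {K. compactin X K \<and> K \<subseteq> V})"

definition induced_measure :: "'a topology \<Rightarrow> ('a set \<Rightarrow> real) \<Rightarrow> 'a set \<Rightarrow> ennreal"
  where "induced_measure X lam V = (SUP K\<in>{K. compactin X K \<and> K \<subseteq> V}. ennreal (lam K))"

end

theory Submission
  imports Defs
begin

text \<open>
  A compact set \<open>K\<close> of \<open>X\<close> is closed, so \<open>f\<close> has an open \<open>f (X - K)\<close> of \<open>Y\<close> over its complement.
  As \<open>Y\<close> is Boolean, the complement \<open>preim K\<close> of that open is an open of \<open>Y\<close> again: \<open>K\<close> has a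
  preimage in \<open>Y\<close>, although it need not be open in \<open>X\<close>. Taking preimages preserves finite unions and
  intersections, and regularity of the content gives \<open>\<mu> (preim K) = \<lambda>(K)\<close> (\<open>measure_preim\<close>).

  The lift of \<open>f\<close> is forced: its inverse image must send a \<open>\<lambda>\<close>-ideal \<open>U\<close> to the supremum \<open>lift U\<close>
  of the opens \<open>preim K\<close> with \<open>K\<close> in \<open>U\<close>. That it preserves suprema is the heart of the matter. It
  has a right adjoint, sending \<open>y\<close> to the set \<open>compacts_below y\<close> of all \<open>K\<close> with \<open>preim K\<close> below
  \<open>y\<close>, and the point is that this set is a \<open>\<lambda>\<close>-ideal (\<open>content_ideal_compacts_below\<close>): if finite
  unions of sets in it exhaust \<open>K\<close> up to arbitrarily small content, then \<open>y \<sqinter> preim K\<close> and \<open>preim K\<close>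
  have the same finite measure, so they agree because \<open>\<mu>\<close> is faithful. Conversely each \<open>\<lambda>\<close>-ideal \<open>U\<close>
  is recovered as \<open>compacts_below (lift U)\<close> (\<open>compacts_below_lift\<close>): if \<open>preim C\<close> lies below
  \<open>lift U\<close>, then the directed supremum of the \<open>\<lambda>(C \<inter> K)\<close> is \<open>\<lambda>(C)\<close>, which is the closure condition
  for \<open>C\<close>. So the \<open>\<lambda>\<close>-ideals form a coreflective part of \<open>Y\<close> closed under finite meets. This shows
  at once that they form a frame and that \<open>lift\<close> is a frame homomorphism. It preserves the measures
  since \<open>\<mu>\<close> commutes with directed suprema.

  The ideal \<open>p\<^sup>* V\<close> is \<open>compacts_below (f V)\<close>, because \<open>X\<close> is locally compact by regularity and
  \<open>f V\<close> is therefore the supremum of the preimages of the compact subsets of \<open>V\<close>. Hence \<open>lift\<close>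
  factors \<open>f\<close>. For uniqueness, every ideal is a supremum of ideals \<open>compacts_below (preim K)\<close>. Such an
  ideal is disjoint from \<open>p\<^sup>* (X - K)\<close>, so a factorization sends it below \<open>preim K\<close>. Its measure is at
  least \<open>\<lambda>(K)\<close>, so faithfulness forces the value \<open>preim K\<close>
  (\<open>factorization_at_compacts_below_preim\<close>).
\<close>

section \<open>Frames and their measures\<close>

context frame
begin

text \<open>
  The binary distributive law in the form in which complements are used below: an open is below \<open>b\<close>
  as soon as its part inside \<open>c\<close> is, provided that \<open>b\<close> and \<open>c\<close> together cover the locale.
\<close>

lemma le_by_cover:
  assumes carr: "a \<in> carrier L" "b \<in> carrier L" "c \<in> carrier L"
    and cover: "b \<squnion> c = \<top>" and le: "a \<sqinter> c \<sqsubseteq> b"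
  shows "a \<sqsubseteq> b"
proof -
  have "a \<sqsubseteq> a \<sqinter> (b \<squnion> c)"
    using carr by (auto simp: cover intro: meet_le top_higher)
  also have "a \<sqinter> (b \<squnion> c) = \<Squnion> ((\<lambda>U. a \<sqinter> U) ` {b, c})"
    unfolding join_def using carr by (intro meet_Sup_distrib) auto
  also have "\<dots> \<sqsubseteq> b"
    using carr le by (intro sup_least) (auto intro: meet_right)
  finally show ?thesis
    using carr by simp
qed

lemma Sup_meet_le:
  assumes carr: "A \<subseteq> carrier L" "B \<subseteq> carrier L" "y \<in> carrier L"
    and le: "\<And>a b. a \<in> A \<Longrightarrow> b \<in> B \<Longrightarrow> a \<sqinter> b \<sqsubseteq> y"
  shows "\<Squnion> A \<sqinter> \<Squnion> B \<sqsubseteq> y"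
proof -
  have "\<Squnion> A \<sqinter> b \<sqsubseteq> y" if "b \<in> B" for b
  proof -
    have "b \<in> carrier L"
      using that carr by auto
    then have "\<Squnion> A \<sqinter> b = \<Squnion> ((\<lambda>a. b \<sqinter> a) ` A)"
      using carr by (metis meet_Sup_distrib meet_comm)
    also have "\<dots> \<sqsubseteq> y"
      using that carr le \<open>b \<in> carrier L\<close>
      by (intro sup_least) (auto simp: meet_comm[of L b] subset_iff)
    finally show ?thesis .
  qed
  then have "\<Squnion> ((\<lambda>b. \<Squnion> A \<sqinter> b) ` B) \<sqsubseteq> y"
    using carr by (intro sup_least) (auto simp: subset_iff)
  then show ?thesis
    using carr by (simp add: meet_Sup_distrib)
qed

text \<open>
  Faithfulness compares opens through their intersections with opens \<open>k\<close> of finite measure. For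
  comparable opens of finite measure the total masses decide, because by modularity \<open>\<nu> a = \<nu> b\<close>
  forces \<open>\<nu> (a \<sqinter> k) = \<nu> (b \<sqinter> k)\<close> for all \<open>k\<close>.
\<close>

lemma eq_if_finite_measure_le:
  assumes \<nu>: "locale_measure L \<nu>" and faithful: "faithful_measure L \<nu>"
    and carr: "a \<in> carrier L" "b \<in> carrier L"
    and le: "a \<sqsubseteq> b" and meas: "\<nu> b \<le> \<nu> a" and fin: "\<nu> b < \<infinity>"
  shows "a = b"
proof -
  have mono: "\<nu> x \<le> \<nu> y" if "x \<in> carrier L" "y \<in> carrier L" "x \<sqsubseteq> y" for x y
    using \<nu> that unfolding locale_measure_def by blast
  have modular: "\<nu> x + \<nu> y = \<nu> (x \<squnion> y) + \<nu> (x \<sqinter> y)" if "x \<in> carrier L" "y \<in> carrier L" for x y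
    using \<nu> that unfolding locale_measure_def by blast
  have "\<nu> (a \<sqinter> k) = \<nu> (b \<sqinter> k)" if k: "k \<in> carrier L" for k
  proof (rule antisym)
    have ak: "a \<sqinter> k \<sqsubseteq> b \<sqinter> k"
      using carr k le by (meson le_trans meet_closed meet_le meet_left meet_right)
    then show "\<nu> (a \<sqinter> k) \<le> \<nu> (b \<sqinter> k)"
      using carr k by (intro mono) auto
    have "\<nu> (a \<squnion> (b \<sqinter> k)) \<le> \<nu> b"
      using carr k le by (intro mono join_le) (auto intro: meet_left)
    then have "\<nu> a + \<nu> (b \<sqinter> k) \<le> \<nu> a + \<nu> (a \<sqinter> (b \<sqinter> k))"
      using modular[of a "b \<sqinter> k"] carr k meas by (auto intro: add_right_mono)
    moreover have "\<nu> a \<noteq> \<infinity>"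
      using mono[OF carr le] fin by auto
    ultimately have "\<nu> (b \<sqinter> k) \<le> \<nu> (a \<sqinter> (b \<sqinter> k))"
      by (simp add: ennreal_add_left_cancel_le)
    also have "\<dots> \<le> \<nu> (a \<sqinter> k)"
    proof (rule mono)
      have "b \<sqinter> k \<sqsubseteq> k"
        using carr k by (simp add: meet_right)
      then show "a \<sqinter> (b \<sqinter> k) \<sqsubseteq> a \<sqinter> k"
        using carr k by (meson le_trans meet_closed meet_le meet_left meet_right)
    qed (use carr k in auto)
    finally show "\<nu> (b \<sqinter> k) \<le> \<nu> (a \<sqinter> k)" .
  qed
  then show ?thesis
    using faithful carr le unfolding faithful_measure_def by blast
qed

end

section \<open>Coreflective subframes\<close>

text \<open>
  If a partial order is embedded in a frame by \<open>q\<close>, the embedding has a right adjoint \<open>r\<close> and its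
  image is closed under finite meets, then all suprema and finite meets of the partial order may be
  computed in the frame. Hence the partial order is itself a frame and \<open>q\<close> is the inverse image of
  a continuous map.
\<close>

locale coreflection = frame Y for Y :: "('b, 'm) gorder_scheme" (structure) +
  fixes P :: "('c, 'n) gorder_scheme" and q :: "'c \<Rightarrow> 'b" and r :: "'b \<Rightarrow> 'c"
  assumes order: "partial_order P"
    and q_closed [simp]: "U \<in> carrier P \<Longrightarrow> q U \<in> carrier Y"
    and r_closed [simp]: "y \<in> carrier Y \<Longrightarrow> r y \<in> carrier P"
    and adjoint: "U \<in> carrier P \<Longrightarrow> y \<in> carrier Y \<Longrightarrow> q U \<sqsubseteq> y \<longleftrightarrow> U \<sqsubseteq>\<^bsub>P\<^esub> r y"
    and r_q [simp]: "U \<in> carrier P \<Longrightarrow> r (q U) = U"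
    and q_top: "q (r \<top>) = \<top>"
    and meet_in_image: "U \<in> carrier P \<Longrightarrow> V \<in> carrier P \<Longrightarrow> q U \<sqinter> q V \<sqsubseteq> q (r (q U \<sqinter> q V))"
begin

interpretation P: partial_order P
  by (rule order)

lemma le_iff_q_le: "U \<in> carrier P \<Longrightarrow> V \<in> carrier P \<Longrightarrow> U \<sqsubseteq>\<^bsub>P\<^esub> V \<longleftrightarrow> q U \<sqsubseteq> q V"
  by (simp add: adjoint)

lemma q_r_le: "y \<in> carrier Y \<Longrightarrow> q (r y) \<sqsubseteq> y"
  by (simp add: adjoint)

lemma is_Sup: "A \<subseteq> carrier P \<Longrightarrow> least P (r (\<Squnion> (q ` A))) (Upper P A)"
proof -
  assume A: "A \<subseteq> carrier P"
  then have qA: "q ` A \<subseteq> carrier Y"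
    by auto
  show "least P (r (\<Squnion> (q ` A))) (Upper P A)"
  proof (rule least_UpperI)
    show "U \<sqsubseteq>\<^bsub>P\<^esub> r (\<Squnion> (q ` A))" if "U \<in> A" for U
      using that A qA by (subst adjoint[symmetric]) (auto intro: sup_upper)
    show "r (\<Squnion> (q ` A)) \<sqsubseteq>\<^bsub>P\<^esub> V" if "V \<in> Upper P A" for V
    proof -
      have V: "V \<in> carrier P" "\<And>U. U \<in> A \<Longrightarrow> q U \<sqsubseteq> q V"
        using that A le_iff_q_le by (auto simp: Upper_def)
      have "q (r (\<Squnion> (q ` A))) \<sqsubseteq> \<Squnion> (q ` A)"
        using qA by (intro q_r_le) auto
      also have "\<dots> \<sqsubseteq> q V"
        using V qA by (intro sup_least) auto
      finally show ?thesis
        using V qA by (simp add: le_iff_q_le)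
    qed
  qed (use A qA in auto)
qed

lemma is_Inf: "A \<subseteq> carrier P \<Longrightarrow> greatest P (r (\<Sqinter> (q ` A))) (Lower P A)"
proof -
  assume A: "A \<subseteq> carrier P"
  then have qA: "q ` A \<subseteq> carrier Y"
    by auto
  show "greatest P (r (\<Sqinter> (q ` A))) (Lower P A)"
  proof (rule greatest_LowerI)
    show "r (\<Sqinter> (q ` A)) \<sqsubseteq>\<^bsub>P\<^esub> U" if "U \<in> A" for U
    proof -
      have "q (r (\<Sqinter> (q ` A))) \<sqsubseteq> \<Sqinter> (q ` A)"
        using qA by (intro q_r_le) auto
      also have "\<dots> \<sqsubseteq> q U"
        using that qA by (intro inf_lower) auto
      finally show ?thesis
        using that A qA by (subst le_iff_q_le) auto
    qed
    show "V \<sqsubseteq>\<^bsub>P\<^esub> r (\<Sqinter> (q ` A))" if "V \<in> Lower P A" for V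
    proof -
      have "V \<in> carrier P" "\<And>U. U \<in> A \<Longrightarrow> q V \<sqsubseteq> q U"
        using that A le_iff_q_le by (auto simp: Lower_def)
      then show ?thesis
        using qA by (subst adjoint[symmetric]) (auto intro: inf_greatest)
    qed
  qed (use A qA in auto)
qed

sublocale P: complete_lattice P
  using is_Sup is_Inf by unfold_locales blast+

lemma Sup_eq: "A \<subseteq> carrier P \<Longrightarrow> \<Squnion>\<^bsub>P\<^esub> A = r (\<Squnion> (q ` A))"
  using is_Sup P.sup_lub P.least_unique by blast

lemma meet_eq: "U \<in> carrier P \<Longrightarrow> V \<in> carrier P \<Longrightarrow> U \<sqinter>\<^bsub>P\<^esub> V = r (q U \<sqinter> q V)"
  using is_Inf[of "{U, V}"] P.inf_glb[of "{U, V}"] P.greatest_unique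
  by (fastforce simp: meet_def)

lemma top_eq: "\<top>\<^bsub>P\<^esub> = r \<top>"
  by (intro P.le_antisym) (auto simp: adjoint[symmetric] intro: top_higher P.top_higher)

lemma q_Sup: "A \<subseteq> carrier P \<Longrightarrow> q (\<Squnion>\<^bsub>P\<^esub> A) = \<Squnion> (q ` A)"
proof -
  assume A: "A \<subseteq> carrier P"
  then have qA: "q ` A \<subseteq> carrier Y"
    by auto
  show ?thesis
  proof (rule le_antisym)
    show "q (\<Squnion>\<^bsub>P\<^esub> A) \<sqsubseteq> \<Squnion> (q ` A)"
      using A qA by (simp add: Sup_eq q_r_le)
    show "\<Squnion> (q ` A) \<sqsubseteq> q (\<Squnion>\<^bsub>P\<^esub> A)"
      using A qA by (intro sup_least) (auto simp: le_iff_q_le[symmetric] subsetD intro!: P.sup_upper)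
  qed (use A qA in auto)
qed

lemma q_meet: "U \<in> carrier P \<Longrightarrow> V \<in> carrier P \<Longrightarrow> q (U \<sqinter>\<^bsub>P\<^esub> V) = q U \<sqinter> q V"
  by (intro le_antisym) (auto simp: meet_eq q_r_le meet_in_image)

text \<open>
  The frame law holds in \<open>P\<close> because \<open>q\<close> carries it to an instance of the law in \<open>Y\<close>, and \<open>q\<close> is
  injective with left inverse \<open>r\<close>.
\<close>

theorem frame_P: "frame P"
proof
  fix V A assume V: "V \<in> carrier P" and A: "A \<subseteq> carrier P"
  then have VA: "(\<lambda>U. V \<sqinter>\<^bsub>P\<^esub> U) ` A \<subseteq> carrier P"
    by auto
  have "q (V \<sqinter>\<^bsub>P\<^esub> \<Squnion>\<^bsub>P\<^esub> A) = q V \<sqinter> \<Squnion> (q ` A)"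
    using V A by (simp add: q_meet q_Sup)
  also have "\<dots> = \<Squnion> ((\<lambda>y. q V \<sqinter> y) ` q ` A)"
    using V A by (intro meet_Sup_distrib) auto
  also have "(\<lambda>y. q V \<sqinter> y) ` q ` A = q ` (\<lambda>U. V \<sqinter>\<^bsub>P\<^esub> U) ` A"
    unfolding image_image using V A by (intro image_cong) (auto simp: q_meet)
  also have "\<Squnion> \<dots> = q (\<Squnion>\<^bsub>P\<^esub> ((\<lambda>U. V \<sqinter>\<^bsub>P\<^esub> U) ` A))"
    using VA by (simp only: q_Sup)
  finally have "r (q (V \<sqinter>\<^bsub>P\<^esub> \<Squnion>\<^bsub>P\<^esub> A)) = r (q (\<Squnion>\<^bsub>P\<^esub> ((\<lambda>U. V \<sqinter>\<^bsub>P\<^esub> U) ` A)))"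
    by simp
  then show "V \<sqinter>\<^bsub>P\<^esub> \<Squnion>\<^bsub>P\<^esub> A = \<Squnion>\<^bsub>P\<^esub> ((\<lambda>U. V \<sqinter>\<^bsub>P\<^esub> U) ` A)"
    using V A VA by simp
qed

theorem continuous_q: "restrict q (carrier P) \<in> continuous_maps Y P"
proof -
  have "restrict q (carrier P) (\<Squnion>\<^bsub>P\<^esub> A) = \<Squnion> (restrict q (carrier P) ` A)"
    if A: "A \<subseteq> carrier P" for A
  proof -
    have "restrict q (carrier P) ` A = q ` A"
      using A by (intro image_cong) auto
    then show ?thesis
      using A by (simp add: q_Sup)
  qed
  then show ?thesis
    using frame_P frame_axioms by (auto simp: continuous_maps_def q_meet top_eq q_top frame_def)
qed

end

section \<open>The frame of opens of a space\<close>

context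
  fixes X :: "'a topology"
begin

interpretation O: frame "opens_frame X"
  by (rule frame_opens_frame)

lemma opens_carrier [simp]: "U \<in> carrier (opens_frame X) \<longleftrightarrow> openin X U"
  by (simp add: opens_frame_def)

lemma opens_le [simp]: "U \<sqsubseteq>\<^bsub>opens_frame X\<^esub> V \<longleftrightarrow> U \<subseteq> V"
  by (simp add: opens_frame_def)

lemma opens_Sup: "(\<And>U. U \<in> A \<Longrightarrow> openin X U) \<Longrightarrow> \<Squnion>\<^bsub>opens_frame X\<^esub> A = \<Union>A"
proof -
  assume A: "\<And>U. U \<in> A \<Longrightarrow> openin X U"
  then have "least (opens_frame X) (\<Union>A) (Upper (opens_frame X) A)"
    by (auto simp: least_def Upper_def)
  moreover have "A \<subseteq> carrier (opens_frame X)"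
    using A by auto
  ultimately show ?thesis
    using O.least_unique O.sup_lub by blast
qed

lemma opens_meet: "openin X U \<Longrightarrow> openin X V \<Longrightarrow> U \<sqinter>\<^bsub>opens_frame X\<^esub> V = U \<inter> V"
proof -
  assume "openin X U" "openin X V"
  then show ?thesis
    using O.meet_left[of U V] O.meet_right[of U V] O.meet_le[of "U \<inter> V" U V] by auto
qed

lemma opens_top: "\<top>\<^bsub>opens_frame X\<^esub> = topspace X"
  using O.top_higher[of "topspace X"] O.top_closed openin_subset[of X "\<top>\<^bsub>opens_frame X\<^esub>"] by auto

end

section \<open>Preimages of compact sets in a Boolean locale\<close>

text \<open>
  The infimum in the definition of regularity is finite, hence not taken over the empty set. This makes
  a space with a regular content locally compact.
\<close>

lemma regular_content_compact_neighbourhood: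
  assumes "regular_content X lam" "compactin X K"
  obtains V K' where "openin X V" "compactin X K'" "K \<subseteq> V" "V \<subseteq> K'"
proof -
  have "{K'. compactin X K' \<and> way_inside X K K'} \<noteq> {}"
  proof
    assume *: "{K'. compactin X K' \<and> way_inside X K K'} = {}"
    have "ennreal (lam K) = (INF K'\<in>{K'. compactin X K' \<and> way_inside X K K'}. ennreal (lam K'))"
      using assms unfolding regular_content_def by blast
    then show False
      unfolding * by simp
  qed
  then show thesis
    using that unfolding way_inside_def by blast
qed

lemma regular_content_neighbourhood_base:
  assumes X: "Hausdorff_space X" and lam: "regular_content X lam"
  shows "neighbourhood_base_of (compactin X) X"
proof -
  have "locally_compact_space X"
    unfolding locally_compact_space_def
  proof
    fix x assume "x \<in> topspace X"
    then have "compactin X {x}"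
      by simp
    from regular_content_compact_neighbourhood[OF lam this]
    show "\<exists>U K. openin X U \<and> compactin X K \<and> x \<in> U \<and> U \<subseteq> K"
      by (metis insert_subset)
  qed
  then show ?thesis
    using X locally_compact_space_neighbourhood_base by blast
qed

locale measured_map = boolean_frame Y for Y :: "'b gorder" (structure) +
  fixes X :: "'a topology" and lam :: "'a set \<Rightarrow> real" and \<mu> :: "'b \<Rightarrow> ennreal"
    and f :: "'a set \<Rightarrow> 'b"
  assumes Hausdorff: "Hausdorff_space X"
    and regular: "regular_content X lam"
    and measure: "locale_measure Y \<mu>"
    and faithful: "faithful_measure Y \<mu>"
    and f: "f \<in> measure_preserving_maps Y \<mu> (opens_frame X) (induced_measure X lam)"
begin

lemma measure_mono: "x \<in> carrier Y \<Longrightarrow> y \<in> carrier Y \<Longrightarrow> x \<sqsubseteq> y \<Longrightarrow> \<mu> x \<le> \<mu> y"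
  using measure unfolding locale_measure_def by blast

lemma measure_modular:
  "x \<in> carrier Y \<Longrightarrow> y \<in> carrier Y \<Longrightarrow> \<mu> x + \<mu> y = \<mu> (x \<squnion> y) + \<mu> (x \<sqinter> y)"
  using measure unfolding locale_measure_def by blast

lemma measure_directed: "directed_family Y D \<Longrightarrow> \<mu> (\<Squnion> D) = (SUP U\<in>D. \<mu> U)"
  using measure unfolding locale_measure_def by blast

lemma f_closed [simp]: "openin X U \<Longrightarrow> f U \<in> carrier Y"
  using f unfolding measure_preserving_maps_def continuous_maps_def by auto

lemma f_extensional: "f \<in> extensional (carrier (opens_frame X))"
  using f unfolding measure_preserving_maps_def continuous_maps_def PiE_def by blast

lemma f_measure: "openin X U \<Longrightarrow> \<mu> (f U) = induced_measure X lam U"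
  using f unfolding measure_preserving_maps_def by auto

lemma f_Union:
  assumes "\<And>U. U \<in> A \<Longrightarrow> openin X U"
  shows "f (\<Union>A) = \<Squnion> (f ` A)"
proof -
  have "A \<subseteq> carrier (opens_frame X)"
    using assms by auto
  then have "f (\<Squnion>\<^bsub>opens_frame X\<^esub> A) = \<Squnion> (f ` A)"
    using f unfolding measure_preserving_maps_def continuous_maps_def by blast
  then show ?thesis
    using assms by (simp add: opens_Sup)
qed

lemma f_Un: "openin X U \<Longrightarrow> openin X V \<Longrightarrow> f (U \<union> V) = f U \<squnion> f V"
  using f_Union[of "{U, V}"] by (auto simp: join_def)

lemma f_Int:
  assumes "openin X U" "openin X V"
  shows "f (U \<inter> V) = f U \<sqinter> f V"
proof -
  have "f (U \<sqinter>\<^bsub>opens_frame X\<^esub> V) = f U \<sqinter> f V"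
    using f assms unfolding measure_preserving_maps_def continuous_maps_def by auto
  then show ?thesis
    using assms by (simp add: opens_meet)
qed

lemma f_topspace: "f (topspace X) = \<top>"
  using f unfolding measure_preserving_maps_def continuous_maps_def opens_top[symmetric] by blast

lemma f_empty: "f {} = \<bottom>"
proof (rule le_antisym)
  have "f (\<Union>{}) = \<Squnion> (f ` {})"
    by (rule f_Union) auto
  then show "f {} \<sqsubseteq> \<bottom>"
    by (auto intro: sup_least)
qed (auto intro: bottom_lower)

lemma f_mono: "openin X U \<Longrightarrow> openin X V \<Longrightarrow> U \<subseteq> V \<Longrightarrow> f U \<sqsubseteq> f V"
  using f_Un[of U V] join_left[of "f U" "f V"] by (simp add: Un_absorb1)

definition preim :: "'a set \<Rightarrow> 'b"
  where "preim K = (SOME y. y \<in> carrier Y \<and> f (topspace X - K) \<sqinter> y = \<bottom> \<and> f (topspace X - K) \<squnion> y = \<top>)"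

lemma open_Compl: "compactin X K \<Longrightarrow> openin X (topspace X - K)"
  using Hausdorff compactin_imp_closedin by blast

lemma preim_props:
  assumes "compactin X K"
  shows "preim K \<in> carrier Y" "preim K \<sqinter> f (topspace X - K) = \<bottom>" "preim K \<squnion> f (topspace X - K) = \<top>"
proof -
  have "\<exists>y. y \<in> carrier Y \<and> f (topspace X - K) \<sqinter> y = \<bottom> \<and> f (topspace X - K) \<squnion> y = \<top>"
    using complement_exists[of "f (topspace X - K)"] assms open_Compl by auto
  from someI_ex[OF this, folded preim_def]
  show "preim K \<in> carrier Y" "preim K \<sqinter> f (topspace X - K) = \<bottom>" "preim K \<squnion> f (topspace X - K) = \<top>"
    by (auto simp: meet_comm join_comm)
qed

lemma preim_closed [simp]: "compactin X K \<Longrightarrow> preim K \<in> carrier Y"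
  by (rule preim_props)

text \<open>
  Complements in a frame are pseudocomplements: \<open>preim K\<close> is the largest open disjoint from
  \<open>f (X - K)\<close>.
\<close>

lemma le_preim:
  assumes "compactin X K" "a \<in> carrier Y" "a \<sqinter> f (topspace X - K) \<sqsubseteq> \<bottom>"
  shows "a \<sqsubseteq> preim K"
proof (rule le_by_cover)
  show "a \<sqinter> f (topspace X - K) \<sqsubseteq> preim K"
    using assms open_Compl bottom_lower by (meson bottom_closed f_closed le_trans meet_closed preim_closed)
qed (use assms open_Compl preim_props in auto)

lemma f_le_preim:
  assumes "compactin X K" "openin X W" "W \<subseteq> K"
  shows "f W \<sqsubseteq> preim K"
proof -
  have "W \<inter> (topspace X - K) = {}"
    using assms by auto
  then have "f W \<sqinter> f (topspace X - K) = \<bottom>"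
    using assms open_Compl f_empty by (metis f_Int)
  then show ?thesis
    using assms by (intro le_preim) auto
qed

lemma preim_le_f:
  assumes "compactin X K" "openin X V" "K \<subseteq> V"
  shows "preim K \<sqsubseteq> f V"
proof (rule le_by_cover)
  have "V \<union> (topspace X - K) = topspace X"
    using assms openin_subset[of X V] by auto
  then show "f V \<squnion> f (topspace X - K) = \<top>"
    using assms open_Compl by (metis f_Un f_topspace)
  show "preim K \<sqinter> f (topspace X - K) \<sqsubseteq> f V"
    using assms by (simp add: preim_props bottom_lower)
qed (use assms open_Compl in auto)

lemma preim_mono:
  assumes "compactin X K" "compactin X C" "K \<subseteq> C"
  shows "preim K \<sqsubseteq> preim C"
proof (rule le_preim)
  have "f (topspace X - C) \<sqsubseteq> f (topspace X - K)"
    using assms open_Compl by (intro f_mono) auto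
  then have "preim K \<sqinter> f (topspace X - C) \<sqsubseteq> preim K \<sqinter> f (topspace X - K)"
    using assms open_Compl by (meson f_closed le_trans meet_closed meet_le meet_left meet_right preim_closed)
  then show "preim K \<sqinter> f (topspace X - C) \<sqsubseteq> \<bottom>"
    using assms by (simp add: preim_props)
qed (use assms in auto)

lemma preim_Int:
  assumes "compactin X K" "compactin X C"
  shows "preim (K \<inter> C) = preim K \<sqinter> preim C"
proof (rule le_antisym)
  have KC: "compactin X (K \<inter> C)"
    using assms Hausdorff by (simp add: compactin_Int)
  show "preim (K \<inter> C) \<sqsubseteq> preim K \<sqinter> preim C"
    using assms KC by (intro meet_le preim_mono) auto
  have c: "f (topspace X - (K \<inter> C)) = f (topspace X - K) \<squnion> f (topspace X - C)"
    using assms open_Compl by (simp add: f_Un[symmetric] Diff_Int)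
  let ?a = "preim K \<sqinter> preim C"
  have "?a \<sqinter> (f (topspace X - K) \<squnion> f (topspace X - C))
      = \<Squnion> ((\<lambda>U. ?a \<sqinter> U) ` {f (topspace X - K), f (topspace X - C)})"
    unfolding join_def using assms open_Compl by (intro meet_Sup_distrib) auto
  also have "\<dots> \<sqsubseteq> \<bottom>"
  proof (rule sup_least)
    have "?a \<sqinter> f (topspace X - K) \<sqsubseteq> preim K \<sqinter> f (topspace X - K)"
      "?a \<sqinter> f (topspace X - C) \<sqsubseteq> preim C \<sqinter> f (topspace X - C)"
      using assms open_Compl by (meson f_closed le_trans meet_closed meet_le meet_left meet_right preim_closed)+
    then show "x \<sqsubseteq> \<bottom>"
      if "x \<in> (\<lambda>U. ?a \<sqinter> U) ` {f (topspace X - K), f (topspace X - C)}" for x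
      using that assms by (auto simp: preim_props)
  qed (use assms open_Compl in auto)
  finally show "?a \<sqsubseteq> preim (K \<inter> C)"
    using assms KC by (intro le_preim) (auto simp: c)
qed (use assms Hausdorff in \<open>auto simp: compactin_Int\<close>)

lemma preim_Un_le:
  assumes "compactin X K" "compactin X C" "y \<in> carrier Y" "preim K \<sqsubseteq> y" "preim C \<sqsubseteq> y"
  shows "preim (K \<union> C) \<sqsubseteq> y"
proof -
  have KC: "compactin X (K \<union> C)"
    using assms by (simp add: compactin_Un)
  let ?a = "preim (K \<union> C)" and ?k = "f (topspace X - K)" and ?c = "f (topspace X - C)"
  have carr: "?a \<in> carrier Y" "?k \<in> carrier Y" "?c \<in> carrier Y" "preim K \<in> carrier Y" "preim C \<in> carrier Y"
    using assms KC open_Compl by auto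
  have kc: "?k \<sqinter> ?c = f (topspace X - (K \<union> C))"
    using assms open_Compl by (simp add: f_Int[symmetric] Diff_Un)
  have "?a \<sqinter> ?k \<sqinter> ?c \<sqsubseteq> \<bottom>"
    using carr KC by (simp add: meet_assoc kc preim_props)
  then have "?a \<sqinter> ?k \<sqsubseteq> preim C"
    using assms carr by (intro le_preim) auto
  then have *: "?a \<sqinter> ?k \<sqsubseteq> y"
    using assms carr by (meson le_trans meet_closed)
  show ?thesis
  proof (rule le_by_cover[OF carr(1) assms(3) carr(2) _ *])
    have "preim K \<squnion> ?k \<sqsubseteq> y \<squnion> ?k"
      using assms carr by (meson join_closed join_le join_left join_right le_trans)
    then have "\<top> \<sqsubseteq> y \<squnion> ?k"
      using assms preim_props by simp
    then show "y \<squnion> ?k = \<top>"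
      using assms carr by (intro le_antisym) (auto intro: top_higher)
  qed
qed

lemma preim_empty: "preim {} = \<bottom>"
proof (rule le_antisym)
  show "preim {} \<sqsubseteq> \<bottom>"
    using preim_le_f[of "{}" "{}"] f_empty by simp
qed (auto intro: bottom_lower)

lemma preim_Union_le:
  assumes "finite F" "\<And>C. C \<in> F \<Longrightarrow> compactin X C \<and> preim C \<sqsubseteq> y" "y \<in> carrier Y"
  shows "compactin X (\<Union>F) \<and> preim (\<Union>F) \<sqsubseteq> y"
  using assms
proof (induction F)
  case empty
  then show ?case
    by (simp add: preim_empty bottom_lower)
next
  case (insert C F)
  then show ?case
    by (auto intro: preim_Un_le compactin_Un)
qed

lemma content_nonneg: "compactin X C \<Longrightarrow> 0 \<le> lam C"
  using regular unfolding regular_content_def content_on_def by blast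

lemma content_mono: "compactin X C \<Longrightarrow> compactin X D \<Longrightarrow> C \<subseteq> D \<Longrightarrow> lam C \<le> lam D"
  using regular unfolding regular_content_def content_on_def by blast

lemma content_disjoint:
  "compactin X C \<Longrightarrow> compactin X D \<Longrightarrow> C \<inter> D = {} \<Longrightarrow> lam (C \<union> D) = lam C + lam D"
  using regular unfolding regular_content_def content_on_def by blast

lemma content_le_induced:
  "compactin X C \<Longrightarrow> C \<subseteq> V \<Longrightarrow> ennreal (lam C) \<le> induced_measure X lam V"
  unfolding induced_measure_def by (rule SUP_upper) auto

lemma induced_le_content:
  "compactin X K \<Longrightarrow> V \<subseteq> K \<Longrightarrow> induced_measure X lam V \<le> ennreal (lam K)"
  unfolding induced_measure_def by (rule SUP_least) (auto intro!: ennreal_leI content_mono)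

text \<open>
  An open set \<open>V\<close> between \<open>K\<close> and a compact set \<open>K'\<close> gives \<open>\<mu> (preim K) \<le> \<mu> (f V) \<le> \<lambda>(K')\<close>, and
  regularity is the statement that such \<open>K'\<close> approximate \<open>K\<close>.
\<close>

lemma measure_preim_le:
  assumes "compactin X K"
  shows "\<mu> (preim K) \<le> ennreal (lam K)"
proof -
  have "\<mu> (preim K) \<le> ennreal (lam K')" if "compactin X K'" "way_inside X K K'" for K'
  proof -
    obtain V where V: "openin X V" "K \<subseteq> V" "V \<subseteq> K'"
      using \<open>way_inside X K K'\<close> unfolding way_inside_def by blast
    then have "\<mu> (preim K) \<le> \<mu> (f V)"
      using assms by (intro measure_mono preim_le_f) auto
    also have "\<dots> \<le> ennreal (lam K')"
      using V that by (simp add: f_measure induced_le_content)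
    finally show ?thesis .
  qed
  then have "\<mu> (preim K) \<le> (INF K'\<in>{K'. compactin X K' \<and> way_inside X K K'}. ennreal (lam K'))"
    by (intro INF_greatest) auto
  also have "\<dots> = ennreal (lam K)"
    using regular assms unfolding regular_content_def by simp
  finally show ?thesis .
qed

text \<open>
  For the lower bound, choose \<open>V\<close> and \<open>K'\<close> as before and put \<open>W = V - K\<close>. Adding \<open>K\<close> to compact subsets of
  \<open>W\<close> yields \<open>\<lambda>\<^sub>*(W) + \<lambda>(K) \<le> \<lambda>\<^sub>*(V)\<close>, while \<open>f V\<close> is covered by \<open>f W\<close> and \<open>preim K\<close>, so that
  \<open>\<lambda>\<^sub>*(V) \<le> \<lambda>\<^sub>*(W) + \<mu> (preim K)\<close>. The finite number \<open>\<lambda>\<^sub>*(W) \<le> \<lambda>(K')\<close> cancels.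
\<close>

lemma measure_preim:
  assumes K: "compactin X K"
  shows "\<mu> (preim K) = ennreal (lam K)"
proof (rule antisym)
  show "\<mu> (preim K) \<le> ennreal (lam K)"
    using K by (rule measure_preim_le)
  obtain V K' where V: "openin X V" "compactin X K'" "K \<subseteq> V" "V \<subseteq> K'"
    using regular_content_compact_neighbourhood[OF regular K] .
  define W where "W = V \<inter> (topspace X - K)"
  have W: "openin X W"
    using V K open_Compl unfolding W_def by auto
  have "f V \<sqsubseteq> preim K \<squnion> f W"
  proof (rule le_by_cover)
    have "\<top> \<sqsubseteq> (preim K \<squnion> f W) \<squnion> f (topspace X - K)"
      unfolding preim_props(3)[OF K, symmetric]
      using K W open_Compl by (meson f_closed join_closed join_le join_left join_right le_trans preim_closed)
    then show "(preim K \<squnion> f W) \<squnion> f (topspace X - K) = \<top>"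
      using K W open_Compl by (intro le_antisym) (auto intro: top_higher)
    show "f V \<sqinter> f (topspace X - K) \<sqsubseteq> preim K \<squnion> f W"
      using K V W open_Compl by (simp add: f_Int[symmetric] W_def[symmetric] join_right)
  qed (use K V W open_Compl in auto)
  then have "\<mu> (f V) \<le> \<mu> (preim K \<squnion> f W)"
    using K V W by (intro measure_mono) auto
  also have "\<dots> \<le> \<mu> (preim K) + \<mu> (f W)"
    using measure_modular[of "preim K" "f W"] K W by simp
  finally have upper: "induced_measure X lam V \<le> induced_measure X lam W + \<mu> (preim K)"
    using V W by (simp add: f_measure add.commute)
  have "ennreal (lam C) + ennreal (lam K) \<le> induced_measure X lam V"
    if C: "compactin X C" "C \<subseteq> W" for C
  proof -
    have "C \<inter> K = {}"
      using C unfolding W_def by auto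
    then have "ennreal (lam C) + ennreal (lam K) = ennreal (lam (C \<union> K))"
      using C K by (simp add: content_disjoint content_nonneg)
    also have "\<dots> \<le> induced_measure X lam V"
      using C K V by (intro content_le_induced) (auto simp: W_def compactin_Un)
    finally show ?thesis .
  qed
  then have "induced_measure X lam W + ennreal (lam K) \<le> induced_measure X lam V"
    unfolding induced_measure_def[of X lam W]
    by (subst ennreal_SUP_add_left[symmetric]) (auto intro!: SUP_least exI[of _ "{}"])
  also note upper
  finally have "induced_measure X lam W + ennreal (lam K) \<le> induced_measure X lam W + \<mu> (preim K)" .
  moreover have "induced_measure X lam W \<le> ennreal (lam K')"
    using V by (intro induced_le_content) (auto simp: W_def)
  then have "induced_measure X lam W \<noteq> \<infinity>"
    by (auto simp: top_unique)
  ultimately show "ennreal (lam K) \<le> \<mu> (preim K)"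
    by (simp add: ennreal_add_left_cancel_le)
qed

text \<open>
  By local compactness, \<open>V\<close> is covered by open sets \<open>W\<close> with \<open>W \<subseteq> K \<subseteq> V\<close> for some compact \<open>K\<close>, and
  then \<open>f W\<close> lies below \<open>preim K\<close>.
\<close>

lemma f_eq_Sup_preim:
  assumes V: "openin X V"
  shows "f V = \<Squnion> (preim ` {K. compactin X K \<and> K \<subseteq> V})" (is "_ = \<Squnion> (preim ` ?S)")
proof (rule le_antisym)
  have carr: "preim ` ?S \<subseteq> carrier Y"
    by auto
  show "\<Squnion> (preim ` ?S) \<sqsubseteq> f V"
    using V carr by (intro sup_least) (auto intro: preim_le_f)
  let ?A = "{W. openin X W \<and> (\<exists>K\<in>?S. W \<subseteq> K)}"
  have "V \<subseteq> \<Union>?A"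
  proof
    fix x assume "x \<in> V"
    then obtain W K where "openin X W" "compactin X K" "x \<in> W" "W \<subseteq> K" "K \<subseteq> V"
      using regular_content_neighbourhood_base[OF Hausdorff regular] V
      unfolding neighbourhood_base_of by metis
    then show "x \<in> \<Union>?A"
      by blast
  qed
  then have "V = \<Union>?A"
    by blast
  then have "f V = \<Squnion> (f ` ?A)"
    using f_Union[of ?A] by simp
  also have "\<dots> \<sqsubseteq> \<Squnion> (preim ` ?S)"
  proof (rule sup_least)
    fix z assume "z \<in> f ` ?A"
    then obtain W K where *: "z = f W" "openin X W" "compactin X K" "K \<subseteq> V" "W \<subseteq> K"
      by blast
    then have "z \<sqsubseteq> preim K"
      by (simp add: f_le_preim)
    moreover have "preim K \<sqsubseteq> \<Squnion> (preim ` ?S)"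
      using * carr by (intro sup_upper) auto
    ultimately show "z \<sqsubseteq> \<Squnion> (preim ` ?S)"
      using * carr by (meson f_closed le_trans preim_closed sup_closed)
  qed (use carr in auto)
  finally show "f V \<sqsubseteq> \<Squnion> (preim ` ?S)" .
  show "\<Squnion> (preim ` ?S) \<in> carrier Y"
    using carr by (rule sup_closed)
qed (use V in auto)

section \<open>The ideals of a content inside the Boolean locale\<close>

text \<open>
  The inverse image of the map into \<open>X\<^sup>\<lambda>\<close> to be constructed, on arbitrary sets of compact sets.
\<close>

definition lift :: "'a set set \<Rightarrow> 'b"
  where "lift U = \<Squnion> (preim ` U)"

definition compacts_below :: "'b \<Rightarrow> 'a set set"
  where "compacts_below y = {K. compactin X K \<and> preim K \<sqsubseteq> y}"

lemma preim_image_carrier: "S \<subseteq> {K. compactin X K} \<Longrightarrow> preim ` S \<subseteq> carrier Y"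
  by auto

lemma lift_closed: "S \<subseteq> {K. compactin X K} \<Longrightarrow> lift S \<in> carrier Y"
  unfolding lift_def by (intro sup_closed preim_image_carrier)

lemma preim_le_lift: "S \<subseteq> {K. compactin X K} \<Longrightarrow> K \<in> S \<Longrightarrow> preim K \<sqsubseteq> lift S"
  unfolding lift_def by (intro sup_upper preim_image_carrier) auto

lemma lift_le_iff:
  assumes "S \<subseteq> {K. compactin X K}" "y \<in> carrier Y"
  shows "lift S \<sqsubseteq> y \<longleftrightarrow> S \<subseteq> compacts_below y"
proof
  assume *: "lift S \<sqsubseteq> y"
  show "S \<subseteq> compacts_below y"
  proof
    fix K assume "K \<in> S"
    then have "compactin X K" "preim K \<sqsubseteq> lift S"
      using assms preim_le_lift by auto
    then show "K \<in> compacts_below y"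
      using * assms lift_closed unfolding compacts_below_def by (auto intro: le_trans)
  qed
next
  assume "S \<subseteq> compacts_below y"
  then show "lift S \<sqsubseteq> y"
    unfolding lift_def compacts_below_def using assms by (intro sup_least) auto
qed

lemma compacts_below_subset: "compacts_below y \<subseteq> {K. compactin X K}"
  unfolding compacts_below_def by auto

text \<open>
  Downward closure and closure under finite unions come from the lattice properties of preimages. The
  closure condition up to \<open>\<epsilon>\<close> is where faithfulness enters: it only yields that \<open>y \<sqinter> preim K\<close> has full
  measure in \<open>preim K\<close>.
\<close>

lemma content_ideal_compacts_below:
  assumes y: "y \<in> carrier Y"
  shows "content_ideal X lam (compacts_below y)"
proof -
  have down: "C \<in> compacts_below y" if "K \<in> compacts_below y" "compactin X C" "C \<subseteq> K" for K C
    using that y preim_mono[of C K] unfolding compacts_below_def by (auto intro: le_trans)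
  have closed: "K \<in> compacts_below y"
    if K: "compactin X K" and sub: "\<K> \<subseteq> compacts_below y" "\<forall>C\<in>\<K>. C \<subseteq> K"
      and approx: "\<forall>\<epsilon>>0. \<exists>F. finite F \<and> F \<subseteq> \<K> \<and> lam K - lam (\<Union>F) < \<epsilon>" for K \<K>
  proof -
    let ?a = "y \<sqinter> preim K"
    have carr: "?a \<in> carrier Y"
      using K y by simp
    have "ennreal (lam K) \<le> \<mu> ?a"
    proof (rule ennreal_le_epsilon)
      fix e :: real assume "0 < e"
      then obtain F where F: "finite F" "F \<subseteq> \<K>" "lam K - lam (\<Union>F) < e"
        using approx by blast
      then have UF: "compactin X (\<Union>F) \<and> preim (\<Union>F) \<sqsubseteq> y"
        using sub y unfolding compacts_below_def by (intro preim_Union_le) auto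
      moreover have "\<Union>F \<subseteq> K"
        using F sub by blast
      ultimately have "preim (\<Union>F) \<sqsubseteq> ?a"
        using K y by (intro meet_le) (auto intro: preim_mono)
      then have le: "ennreal (lam (\<Union>F)) \<le> \<mu> ?a"
        using UF carr by (subst measure_preim[symmetric]) (auto intro: measure_mono)
      have "ennreal (lam K) \<le> ennreal (lam (\<Union>F) + e)"
        using F by (intro ennreal_leI) simp
      also have "\<dots> = ennreal (lam (\<Union>F)) + ennreal e"
        using UF \<open>0 < e\<close> by (intro ennreal_plus) (auto intro: content_nonneg)
      finally show "ennreal (lam K) \<le> \<mu> ?a + ennreal e"
        using le by (meson add_right_mono order_trans)
    qed
    then have "?a = preim K"
      using K y by (intro eq_if_finite_measure_le[OF measure faithful]) (auto simp: measure_preim meet_right)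
    then have "preim K \<sqsubseteq> y"
      using K y meet_left[of y "preim K"] by simp
    then show ?thesis
      using K unfolding compacts_below_def by simp
  qed
  show ?thesis
    unfolding content_ideal_def
  proof (intro conjI ballI allI impI)
    show "compacts_below y \<subseteq> {K. compactin X K}"
      by (rule compacts_below_subset)
    show "C \<in> compacts_below y" if "K \<in> compacts_below y" "compactin X C \<and> C \<subseteq> K" for K C
      using that by (elim conjE) (rule down)
    show "K \<in> compacts_below y"
      if "compactin X K \<and> \<K> \<subseteq> compacts_below y \<and> (\<forall>C\<in>\<K>. C \<subseteq> K) \<and>
        (\<forall>\<epsilon>>0. \<exists>F. finite F \<and> F \<subseteq> \<K> \<and> lam K - lam (\<Union>F) < \<epsilon>)" for K \<K>
      using that by (elim conjE) (rule closed)
  qed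
qed

lemma content_idealD:
  assumes "content_ideal X lam U"
  shows "U \<subseteq> {K. compactin X K}"
    and "K \<in> U \<Longrightarrow> compactin X C \<Longrightarrow> C \<subseteq> K \<Longrightarrow> C \<in> U"
    and "compactin X K \<Longrightarrow> \<K> \<subseteq> U \<Longrightarrow> (\<And>C. C \<in> \<K> \<Longrightarrow> C \<subseteq> K) \<Longrightarrow>
      (\<And>\<epsilon>. 0 < \<epsilon> \<Longrightarrow> \<exists>F. finite F \<and> F \<subseteq> \<K> \<and> lam K - lam (\<Union>F) < \<epsilon>) \<Longrightarrow> K \<in> U"
proof -
  show "U \<subseteq> {K. compactin X K}" "K \<in> U \<Longrightarrow> compactin X C \<Longrightarrow> C \<subseteq> K \<Longrightarrow> C \<in> U"
    using assms unfolding content_ideal_def by blast+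
  assume "compactin X K" "\<K> \<subseteq> U" "\<And>C. C \<in> \<K> \<Longrightarrow> C \<subseteq> K"
    and "\<And>\<epsilon>. 0 < \<epsilon> \<Longrightarrow> \<exists>F. finite F \<and> F \<subseteq> \<K> \<and> lam K - lam (\<Union>F) < \<epsilon>"
  then have "compactin X K \<and> \<K> \<subseteq> U \<and> (\<forall>C\<in>\<K>. C \<subseteq> K) \<and>
      (\<forall>\<epsilon>>0. \<exists>F. finite F \<and> F \<subseteq> \<K> \<and> lam K - lam (\<Union>F) < \<epsilon>)"
    by simp
  then show "K \<in> U"
    using assms[unfolded content_ideal_def, THEN conjunct2, THEN conjunct2, rule_format, of K \<K>]
    by simp
qed

text \<open>Here the closure condition is applied to the empty family, whose union is \<open>{}\<close> itself.\<close>

lemma content_ideal_empty: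
  assumes "content_ideal X lam U"
  shows "{} \<in> U"
  by (rule content_idealD(3)[OF assms, of "{}" "{}"]) auto

lemma content_ideal_Un:
  assumes U: "content_ideal X lam U" and KC: "K \<in> U" "C \<in> U"
  shows "K \<union> C \<in> U"
proof (rule content_idealD(3)[OF U, of _ "{K, C}"])
  show "compactin X (K \<union> C)"
    using content_idealD(1)[OF U] KC by (auto intro: compactin_Un)
  show "\<exists>F. finite F \<and> F \<subseteq> {K, C} \<and> lam (K \<union> C) - lam (\<Union>F) < \<epsilon>" if "0 < \<epsilon>" for \<epsilon>
    using that by (intro exI[of _ "{K, C}"]) auto
qed (use KC in auto)

lemma measure_lift:
  assumes S: "S \<subseteq> {K. compactin X K}" "S \<noteq> {}" and Un: "\<And>K C. K \<in> S \<Longrightarrow> C \<in> S \<Longrightarrow> K \<union> C \<in> S"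
  shows "\<mu> (lift S) = inner_measure lam S"
proof -
  have "directed_family Y (preim ` S)"
    unfolding directed_family_def
  proof (intro conjI ballI)
    fix x y assume "x \<in> preim ` S" "y \<in> preim ` S"
    then obtain K C where KC: "K \<in> S" "C \<in> S" "x = preim K" "y = preim C"
      by blast
    then have "K \<union> C \<in> S" "compactin X K" "compactin X C" "compactin X (K \<union> C)"
      using S Un[of K C] by auto
    then show "\<exists>z\<in>preim ` S. x \<sqsubseteq> z \<and> y \<sqsubseteq> z"
      using KC by (intro bexI[of _ "preim (K \<union> C)"]) (auto intro: preim_mono)
  qed (use S in auto)
  then have "\<mu> (lift S) = (SUP K\<in>S. \<mu> (preim K))"
    unfolding lift_def by (simp add: measure_directed image_image)
  also have "\<dots> = inner_measure lam S"
    unfolding inner_measure_def using S by (intro SUP_cong) (auto simp: measure_preim)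
  finally show ?thesis .
qed

lemma lift_meet_le:
  assumes U: "U \<subseteq> {K. compactin X K}" and V: "V \<subseteq> {K. compactin X K}" and y: "y \<in> carrier Y"
    and le: "\<And>K C. K \<in> U \<Longrightarrow> C \<in> V \<Longrightarrow> preim (K \<inter> C) \<sqsubseteq> y"
  shows "lift U \<sqinter> lift V \<sqsubseteq> y"
  unfolding lift_def
proof (rule Sup_meet_le)
  fix a b assume "a \<in> preim ` U" "b \<in> preim ` V"
  then obtain K C where KC: "K \<in> U" "C \<in> V" "a = preim K" "b = preim C"
    by blast
  moreover have "compactin X K" "compactin X C"
    using KC U V by auto
  ultimately show "a \<sqinter> b \<sqsubseteq> y"
    using le[of K C] by (simp add: preim_Int)
qed (use U V y in auto)

text \<open>
  Let \<open>preim C\<close> lie below \<open>lift U\<close>. By distributivity it already lies below the supremum of the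
  preimages of the members of \<open>U\<close> contained in \<open>C\<close>. These members are directed, so their contents
  approach \<open>\<lambda>(C)\<close>, and the closure condition puts \<open>C\<close> into \<open>U\<close>.
\<close>

lemma compacts_below_lift:
  assumes U: "content_ideal X lam U"
  shows "compacts_below (lift U) = U"
proof
  have sub: "U \<subseteq> {K. compactin X K}"
    using U by (rule content_idealD)
  then show "U \<subseteq> compacts_below (lift U)"
    using lift_closed lift_le_iff by blast
  show "compacts_below (lift U) \<subseteq> U"
  proof
    fix C assume "C \<in> compacts_below (lift U)"
    then have C: "compactin X C" "preim C \<sqsubseteq> lift U"
      unfolding compacts_below_def by auto
    define D where "D = {K\<in>U. K \<subseteq> C}"
    have D: "D \<subseteq> {K. compactin X K}" "{} \<in> D" "\<And>K K'. K \<in> D \<Longrightarrow> K' \<in> D \<Longrightarrow> K \<union> K' \<in> D"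
      using sub U content_ideal_empty content_ideal_Un unfolding D_def by auto
    have "lift {C} = preim C"
      unfolding lift_def using C by simp
    then have "preim C \<sqsubseteq> lift {C} \<sqinter> lift U"
      using C sub lift_closed by (auto intro: meet_le)
    also have "\<dots> \<sqsubseteq> lift D"
    proof (rule lift_meet_le)
      fix K K' assume "K \<in> {C}" "K' \<in> U"
      then have "K \<inter> K' \<in> D"
        using U sub C Hausdorff content_idealD(2)[OF U, of K' "K \<inter> K'"]
        unfolding D_def by (auto simp: compactin_Int)
      then show "preim (K \<inter> K') \<sqsubseteq> lift D"
        using D preim_le_lift by blast
    qed (use sub C D lift_closed in auto)
    finally have "preim C \<sqsubseteq> lift D"
      using sub C D lift_closed by auto
    then have "\<mu> (preim C) \<le> \<mu> (lift D)"
      using C D lift_closed by (intro measure_mono) auto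
    then have C_le: "ennreal (lam C) \<le> (SUP K\<in>D. ennreal (lam K))"
      using C measure_lift[OF D(1) _ D(3)] ex_in_conv[of D] D(2)
      by (metis measure_preim inner_measure_def)
    \<comment> \<open>The bound \<open>0 \<le> lam {} \<le> lam C - e\<close> excludes truncation of a negative number to \<open>0\<close> in \<^typ>\<open>ennreal\<close>.\<close>
    have "\<exists>K\<in>D. lam C - lam K < e" if "0 < e" for e
    proof (rule ccontr)
      assume "\<not> ?thesis"
      then have *: "lam K \<le> lam C - e" if "K \<in> D" for K
        using that by force
      have "ennreal (lam C) \<le> ennreal (lam C - e)"
        using C_le by (rule order_trans) (auto intro!: SUP_least ennreal_leI *)
      moreover have "0 \<le> lam C - e"
        using *[OF D(2)] content_nonneg[of "{}"] by simp
      ultimately show False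
        using \<open>0 < e\<close> by (simp add: ennreal_le_iff)
    qed
    then have approx: "\<exists>F. finite F \<and> F \<subseteq> D \<and> lam C - lam (\<Union>F) < e" if "0 < e" for e
      using that by (metis bot.extremum ccpo_Sup_singleton finite.emptyI finite_insert insert_subset)
    show "C \<in> U"
      by (rule content_idealD(3)[OF U C(1) _ _ approx]) (auto simp: D_def)
  qed
qed

lemma content_carrier [simp]: "U \<in> carrier (content_frame X lam) \<longleftrightarrow> content_ideal X lam U"
  by (simp add: content_frame_def)

lemma content_le [simp]: "U \<sqsubseteq>\<^bsub>content_frame X lam\<^esub> V \<longleftrightarrow> U \<subseteq> V"
  by (simp add: content_frame_def)

lemma subset_compacts_below_lift:
  assumes "S \<subseteq> {K. compactin X K}"
  shows "S \<subseteq> compacts_below (lift S)"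
  using lift_le_iff[OF assms lift_closed[OF assms]] lift_closed[OF assms] by simp

lemma lift_compacts_below_lift:
  assumes S: "S \<subseteq> {K. compactin X K}"
  shows "lift (compacts_below (lift S)) = lift S"
proof (rule le_antisym)
  show "lift (compacts_below (lift S)) \<sqsubseteq> lift S"
    using lift_le_iff[OF compacts_below_subset lift_closed[OF S]] by simp
  show "lift S \<sqsubseteq> lift (compacts_below (lift S))"
    unfolding lift_def[of S]
  proof (rule sup_least[OF preim_image_carrier[OF S] lift_closed[OF compacts_below_subset]])
    fix x assume "x \<in> preim ` S"
    then show "x \<sqsubseteq> lift (compacts_below (\<Squnion> (preim ` S)))"
      using subset_compacts_below_lift[OF S] unfolding lift_def[of S, symmetric]
      by (auto intro: preim_le_lift[OF compacts_below_subset])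
  qed
qed (use S in \<open>auto intro: lift_closed[OF compacts_below_subset] lift_closed\<close>)

lemma f_eq_lift: "openin X V \<Longrightarrow> f V = lift {K. compactin X K \<and> K \<subseteq> V}"
  unfolding lift_def by (rule f_eq_Sup_preim)

text \<open>
  For closure under finite meets, the meet of \<open>lift U\<close> and \<open>lift V\<close> is the supremum of the opens
  \<open>preim (K \<inter> C)\<close> with \<open>K \<in> U\<close> and \<open>C \<in> V\<close>, and the top of \<open>Y\<close> is \<open>f X\<close>, the supremum of the
  preimages of all compact sets.
\<close>

lemma coreflection_content_frame: "coreflection Y (content_frame X lam) lift compacts_below"
proof (intro coreflection.intro coreflection_axioms.intro frame_axioms)
  show "partial_order (content_frame X lam)"
    by unfold_locales (auto simp: content_frame_def)
  have "compacts_below \<top> = {K. compactin X K \<and> K \<subseteq> topspace X}"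
    unfolding compacts_below_def by (auto intro: top_higher dest: compactin_subset_topspace)
  then show "lift (compacts_below \<top>) = \<top>"
    using f_eq_lift[of "topspace X"] by (simp add: f_topspace)
  show "lift U \<sqinter> lift V \<sqsubseteq> lift (compacts_below (lift U \<sqinter> lift V))"
    if "U \<in> carrier (content_frame X lam)" "V \<in> carrier (content_frame X lam)" for U V
  proof -
    have UV: "U \<subseteq> {K. compactin X K}" "V \<subseteq> {K. compactin X K}"
      using that content_idealD(1) by auto
    show ?thesis
    proof (rule lift_meet_le[OF UV])
      fix K C assume KC: "K \<in> U" "C \<in> V"
      have K: "compactin X K" "preim K \<sqsubseteq> lift U" and C: "compactin X C" "preim C \<sqsubseteq> lift V"
        using UV KC preim_le_lift by auto
      then have "preim K \<sqinter> preim C \<sqsubseteq> lift U \<sqinter> lift V"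
        using UV lift_closed by (meson le_trans meet_closed meet_le meet_left meet_right preim_closed)
      then have "K \<inter> C \<in> compacts_below (lift U \<sqinter> lift V)"
        using K C Hausdorff unfolding compacts_below_def by (simp add: preim_Int compactin_Int)
      then show "preim (K \<inter> C) \<sqsubseteq> lift (compacts_below (lift U \<sqinter> lift V))"
        by (rule preim_le_lift[OF compacts_below_subset])
    next
      show "lift (compacts_below (lift U \<sqinter> lift V)) \<in> carrier Y"
        by (rule lift_closed[OF compacts_below_subset])
    qed
  qed
  show "lift U \<in> carrier Y" if "U \<in> carrier (content_frame X lam)" for U
    using that by (simp add: lift_closed content_idealD(1))
  show "compacts_below y \<in> carrier (content_frame X lam)" if "y \<in> carrier Y" for y
    using that by (simp add: content_ideal_compacts_below)
  show "lift U \<sqsubseteq> y \<longleftrightarrow> U \<sqsubseteq>\<^bsub>content_frame X lam\<^esub> compacts_below y"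
    if "U \<in> carrier (content_frame X lam)" "y \<in> carrier Y" for U y
    using that by (simp add: lift_le_iff content_idealD(1))
  show "compacts_below (lift U) = U" if "U \<in> carrier (content_frame X lam)" for U
    using that by (simp add: compacts_below_lift)
qed

interpretation ideals: coreflection Y "content_frame X lam" lift compacts_below
  by (rule coreflection_content_frame)

text \<open>
  Every \<open>\<lambda>\<close>-ideal \<open>I\<close> containing \<open>S\<close> equals \<open>compacts_below (lift I)\<close>, hence contains
  \<open>compacts_below (lift S)\<close>, which is itself such an ideal.
\<close>

lemma generated_ideal_eq_compacts_below:
  assumes S: "S \<subseteq> {K. compactin X K}"
  shows "generated_ideal X lam S = compacts_below (lift S)"
proof
  show "generated_ideal X lam S \<subseteq> compacts_below (lift S)"
    unfolding generated_ideal_def using content_ideal_compacts_below[OF lift_closed[OF S]] subset_compacts_below_lift[OF S] by blast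
  have "compacts_below (lift S) \<subseteq> I" if I: "content_ideal X lam I" "S \<subseteq> I" for I
  proof -
    have "lift S \<sqsubseteq> lift I"
      using I S lift_closed content_idealD(1) compacts_below_lift by (subst lift_le_iff) auto
    then have "compacts_below (lift S) \<subseteq> compacts_below (lift I)"
      using S I lift_closed content_idealD(1) unfolding compacts_below_def
      by (auto intro: le_trans[of _ "lift S" "lift I"])
    then show ?thesis
      using I compacts_below_lift by simp
  qed
  then show "compacts_below (lift S) \<subseteq> generated_ideal X lam S"
    unfolding generated_ideal_def by blast
qed

lemma natural_map_eq_compacts_below: "openin X V \<Longrightarrow> natural_map X lam V = compacts_below (f V)"
  by (simp add: natural_map_def f_eq_lift generated_ideal_eq_compacts_below Collect_mono)

lemma lift_natural_map: "openin X V \<Longrightarrow> lift (natural_map X lam V) = f V"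
  using lift_compacts_below_lift[of "{K. compactin X K \<and> K \<subseteq> V}"]
  by (auto simp: natural_map_eq_compacts_below f_eq_lift)

section \<open>Existence and uniqueness of the factorization\<close>

theorem lift_measure_preserving:
  "restrict lift (carrier (content_frame X lam))
    \<in> measure_preserving_maps Y \<mu> (content_frame X lam) (inner_measure lam)"
proof -
  have "\<mu> (lift U) = inner_measure lam U" if U: "content_ideal X lam U" for U
    using content_ideal_empty[OF U] content_ideal_Un[OF U] content_idealD(1)[OF U]
    by (intro measure_lift) auto
  then show ?thesis
    unfolding measure_preserving_maps_def using ideals.continuous_q by simp
qed

theorem lift_factors:
  "map_comp_loc (opens_frame X) (natural_map X lam) (restrict lift (carrier (content_frame X lam))) = f"
proof
  fix V
  show "map_comp_loc (opens_frame X) (natural_map X lam)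
      (restrict lift (carrier (content_frame X lam))) V = f V"
  proof (cases "openin X V")
    case True
    then show ?thesis
      using content_ideal_compacts_below[of "f V"] lift_natural_map[of V]
      by (simp add: map_comp_loc_def compose_def natural_map_eq_compacts_below)
  next
    case False
    then show ?thesis
      using f_extensional by (simp add: map_comp_loc_def compose_def extensional_def)
  qed
qed

text \<open>
  The ideal \<open>compacts_below (preim K)\<close> stands for the open of \<open>X\<^sup>\<lambda>\<close> given by \<open>K\<close>. It meets
  \<open>p\<^sup>* (X - K)\<close> in the least ideal, so its image under a factorization is disjoint from \<open>f (X - K)\<close>
  and thus below \<open>preim K\<close>. The measures leave no room for a difference.
\<close>

lemma factorization_at_compacts_below_preim:
  assumes ft: "ft \<in> measure_preserving_maps Y \<mu> (content_frame X lam) (inner_measure lam)"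
    and factors: "map_comp_loc (opens_frame X) (natural_map X lam) ft = f"
    and K: "compactin X K"
  shows "ft (compacts_below (preim K)) = preim K"
proof -
  let ?P = "content_frame X lam" and ?N = "compacts_below (preim K)" and ?O = "topspace X - K"
  have closed: "ft U \<in> carrier Y" if "content_ideal X lam U" for U
    using ft that unfolding measure_preserving_maps_def continuous_maps_def by auto
  have meet: "ft (U \<sqinter>\<^bsub>?P\<^esub> V) = ft U \<sqinter> ft V" if "content_ideal X lam U" "content_ideal X lam V" for U V
    using ft that unfolding measure_preserving_maps_def continuous_maps_def by auto
  have Sup: "ft (\<Squnion>\<^bsub>?P\<^esub> A) = \<Squnion> (ft ` A)" if "A \<subseteq> carrier ?P" for A
    using ft that unfolding measure_preserving_maps_def continuous_maps_def by blast
  have meas: "\<mu> (ft U) = inner_measure lam U" if "content_ideal X lam U" for U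
    using ft that unfolding measure_preserving_maps_def by auto
  have O: "openin X ?O"
    using K by (rule open_Compl)
  have N: "content_ideal X lam ?N"
    using K by (simp add: content_ideal_compacts_below)
  have fO: "ft (compacts_below (f ?O)) = f ?O"
    using O factors unfolding map_comp_loc_def compose_def
    by (metis (no_types, lifting) natural_map_eq_compacts_below opens_carrier restrict_apply')
  have "?N \<sqinter>\<^bsub>?P\<^esub> compacts_below (f ?O) \<subseteq> compacts_below \<bottom>"
  proof -
    have "?N \<sqinter>\<^bsub>?P\<^esub> compacts_below (f ?O) \<subseteq> ?N \<inter> compacts_below (f ?O)"
      using N content_ideal_compacts_below[of "f ?O"] O ideals.P.meet_left[of ?N "compacts_below (f ?O)"]
        ideals.P.meet_right[of ?N "compacts_below (f ?O)"] by auto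
    also have "\<dots> \<subseteq> compacts_below (preim K \<sqinter> f ?O)"
      using K O unfolding compacts_below_def by (auto intro: meet_le)
    finally show ?thesis
      using K by (simp add: preim_props)
  qed
  moreover have "compacts_below \<bottom> \<subseteq> \<Squnion>\<^bsub>?P\<^esub> {}"
    unfolding compacts_below_def[of \<bottom>] ideals.Sup_eq[OF empty_subsetI]
    by (auto simp: compacts_below_def intro: le_trans[of _ \<bottom>] bottom_lower)
  ultimately have "?N \<sqinter>\<^bsub>?P\<^esub> compacts_below (f ?O) \<subseteq> \<Squnion>\<^bsub>?P\<^esub> {}"
    by simp
  moreover have "\<Squnion>\<^bsub>?P\<^esub> {} \<subseteq> ?N \<sqinter>\<^bsub>?P\<^esub> compacts_below (f ?O)"
    using ideals.P.sup_least[of "{}" "?N \<sqinter>\<^bsub>?P\<^esub> compacts_below (f ?O)"]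
      ideals.P.meet_closed[of ?N "compacts_below (f ?O)"] N O content_ideal_compacts_below[of "f ?O"] by simp
  ultimately have "?N \<sqinter>\<^bsub>?P\<^esub> compacts_below (f ?O) = \<Squnion>\<^bsub>?P\<^esub> {}"
    by (rule subset_antisym)
  then have "ft ?N \<sqinter> f ?O = \<Squnion> {}"
    using meet[of ?N "compacts_below (f ?O)"] N O content_ideal_compacts_below[of "f ?O"] fO Sup[of "{}"] by simp
  moreover have "\<Squnion> {} \<sqsubseteq> \<bottom>"
    by (rule sup_least) auto
  ultimately have le: "ft ?N \<sqsubseteq> preim K"
    using K N closed by (intro le_preim) auto
  have "ennreal (lam K) \<le> inner_measure lam ?N"
    unfolding inner_measure_def using K by (intro SUP_upper) (auto simp: compacts_below_def)
  then have "\<mu> (preim K) \<le> \<mu> (ft ?N)"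
    using K N by (simp add: measure_preim meas)
  then show ?thesis
    using K N le closed
    by (intro eq_if_finite_measure_le[OF measure faithful]) (auto simp: measure_preim)
qed

text \<open>Each ideal \<open>U\<close> is the supremum of the ideals \<open>compacts_below (preim K)\<close> with \<open>K \<in> U\<close>.\<close>

theorem factorization_unique:
  assumes ft: "ft \<in> measure_preserving_maps Y \<mu> (content_frame X lam) (inner_measure lam)"
    and factors: "map_comp_loc (opens_frame X) (natural_map X lam) ft = f"
  shows "ft = restrict lift (carrier (content_frame X lam))"
proof (rule extensionalityI[of _ "carrier (content_frame X lam)"])
  let ?P = "content_frame X lam"
  show "ft \<in> extensional (carrier ?P)"
    using ft unfolding measure_preserving_maps_def continuous_maps_def PiE_def by blast
  fix U assume "U \<in> carrier ?P"
  then have U: "content_ideal X lam U" "U \<subseteq> {K. compactin X K}"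
    using content_idealD(1) by auto
  let ?A = "(\<lambda>K. compacts_below (preim K)) ` U"
  have A: "?A \<subseteq> carrier ?P"
    using U content_ideal_compacts_below by auto
  have "lift (compacts_below (preim K)) = preim K" if "K \<in> U" for K
    using lift_compacts_below_lift[of "{K}"] that U by (auto simp: lift_def)
  then have "lift ` ?A = preim ` U"
    by (auto simp: image_image)
  then have "\<Squnion>\<^bsub>?P\<^esub> ?A = U"
    using A U compacts_below_lift by (simp add: ideals.Sup_eq lift_def)
  moreover have "ft (\<Squnion>\<^bsub>?P\<^esub> ?A) = \<Squnion> (ft ` ?A)"
    using ft A unfolding measure_preserving_maps_def continuous_maps_def by blast
  moreover have "ft ` ?A = preim ` U"
    unfolding image_image using U factorization_at_compacts_below_preim[OF ft factors]
    by (intro image_cong) auto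
  ultimately show "ft U = restrict lift (carrier ?P) U"
    using U by (simp add: lift_def)
qed simp

end

theorem theorem1p13:
  fixes X :: "'a topology"
    and lam :: "'a set \<Rightarrow> real"
    and Y :: "'b gorder"
    and \<mu> :: "'b \<Rightarrow> ennreal"
    and f :: "'a set \<Rightarrow> 'b"
  assumes "Hausdorff_space X"
    and "regular_content X lam"
    and "locally_finite_measure (opens_frame X) (induced_measure X lam)"
    and "boolean_frame Y"
    and "locale_measure Y \<mu>"
    and "locally_finite_measure Y \<mu>"
    and "faithful_measure Y \<mu>"
    and "f \<in> measure_preserving_maps Y \<mu> (opens_frame X) (induced_measure X lam)"
  shows "\<exists>!ft. ft \<in> measure_preserving_maps Y \<mu> (content_frame X lam) (inner_measure lam) \<and>
               map_comp_loc (opens_frame X) (natural_map X lam) ft = f"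
proof -
  interpret boolean_frame Y
    by fact
  interpret measured_map Y X lam \<mu> f
    by unfold_locales fact+
  show ?thesis
    using lift_measure_preserving lift_factors factorization_unique by blast
qed

end
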